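(* Let $\theta\in\mathbb R/(2\pi\mathbb Z)$ and $h\in\mathbb R\setminus\{0\}$. Let $g(t)\in G$, $t\in\mathbb R$, be the geodesic-spiral given in the coordinates $(x,y,z)$ by $$x(t)=\frac{\sin(\theta+ht)-\sin\theta}{h},\quad y(t)=\frac{\cos\theta-\cos(\theta+ht)}{h},\quad z(t)=\frac{ht-\sin ht}{2h^2},$$ and let $\Gamma=\{\pi(g(t))\mid t\in\mathbb R\}\subset M$ be its projection to $M$. 1) The projection $p:M\to\mathbb T^2$ sends $\Gamma$ to a contractible closed curve $\gamma\subset\mathbb T^2$ (which may have self-intersections). 2) The curve $\Gamma$ is either closed, which holds if and only if $h^2\in\pi\mathbb Q\setminus\{0\}$; or dense in the preimage $p^{-1}(\gamma)\subset M$, if $h^2\notin\pi\mathbb Q$.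
   Context: $G$ is the 3D Heisenberg group of real unipotent upper triangular matrices $\begin{pmatrix}1&a&c\\0&1&b\\0&0&1\end{pmatrix}$, with coordinates $(a,b,c)$ and product $(a,b,c)\cdot(\bar a,\bar b,\bar c)=(a+\bar a,\,b+\bar b,\,c+\bar c+a\bar b)$. The coordinates $(x,y,z)$ on $G$ are defined by $a=x$, $b=y$, $c=z+\frac{xy}{2}$. $H\subset G$ is the discrete subgroup of elements with $a,b,c\in\mathbb Z$. $M=H\backslash G=\{Hg\mid g\in G\}$ is the (compact) Heisenberg 3D nil-manifold, $\pi:G\to M$, $g\mapsto Hg$, is the projection. The map $p:M\to\mathbb T^2=\mathbb R^2/\mathbb Z^2$ is induced by $(a,b,c)\mapsto(a,b)$. A curve parametrized by $t\in\mathbb R$ is called closed if it is periodic in $t$. *)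

theory Defs
  imports "HOL-Analysis.Analysis" "HOL-Algebra.Coset"
begin

section \<open>Quotient topology\<close>

definition quotient_topology :: "'a topology \<Rightarrow> ('a \<Rightarrow> 'b) \<Rightarrow> 'b topology" where
  "quotient_topology X q =
     topology (\<lambda>U. U \<subseteq> q ` topspace X \<and> openin X {x \<in> topspace X. q x \<in> U})"

lemma openin_quotient_topology:
  "openin (quotient_topology X q) U \<longleftrightarrow>
     U \<subseteq> q ` topspace X \<and> openin X {x \<in> topspace X. q x \<in> U}"
proof -
  have "istopology (\<lambda>U. U \<subseteq> q ` topspace X \<and> openin X {x \<in> topspace X. q x \<in> U})"
    unfolding istopology_def
  proof (rule conjI; intro allI impI)
    fix S T
    assume S: "S \<subseteq> q ` topspace X \<and> openin X {x \<in> topspace X. q x \<in> S}"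
      and T: "T \<subseteq> q ` topspace X \<and> openin X {x \<in> topspace X. q x \<in> T}"
    have "openin X ({x \<in> topspace X. q x \<in> S} \<inter> {x \<in> topspace X. q x \<in> T})"
      using S T by (intro openin_Int) auto
    moreover have "{x \<in> topspace X. q x \<in> S \<inter> T} =
        {x \<in> topspace X. q x \<in> S} \<inter> {x \<in> topspace X. q x \<in> T}" by blast
    ultimately show "S \<inter> T \<subseteq> q ` topspace X \<and> openin X {x \<in> topspace X. q x \<in> S \<inter> T}"
      using S by auto
  next
    fix \<K>
    assume K: "\<forall>K\<in>\<K>. K \<subseteq> q ` topspace X \<and> openin X {x \<in> topspace X. q x \<in> K}"
    have "{x \<in> topspace X. q x \<in> \<Union>\<K>} = (\<Union>K\<in>\<K>. {x \<in> topspace X. q x \<in> K})" by blast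
    moreover have "openin X (\<Union>K\<in>\<K>. {x \<in> topspace X. q x \<in> K})"
      using K by (intro openin_Union) auto
    ultimately show "\<Union>\<K> \<subseteq> q ` topspace X \<and> openin X {x \<in> topspace X. q x \<in> \<Union>\<K>}"
      using K by auto
  qed
  then show ?thesis
    by (simp add: quotient_topology_def topology_inverse')
qed

lemma topspace_quotient_topology [simp]:
  "topspace (quotient_topology X q) = q ` topspace X"
proof
  show "topspace (quotient_topology X q) \<subseteq> q ` topspace X"
    using openin_quotient_topology by fastforce
  have "{x \<in> topspace X. q x \<in> q ` topspace X} = topspace X" by blast
  then have "openin (quotient_topology X q) (q ` topspace X)"
    by (simp add: openin_quotient_topology)
  then show "q ` topspace X \<subseteq> topspace (quotient_topology X q)"
    by (rule openin_subset)
qed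

lemma quotient_map_quotient_topology: "quotient_map X (quotient_topology X q) q"
  by (simp add: quotient_map_def openin_quotient_topology)


section \<open>The Heisenberg group\<close>

definition heis_mat :: "real \<Rightarrow> real \<Rightarrow> real \<Rightarrow> real^3^3" where
  "heis_mat a b c = vector [vector [1, a, c], vector [0, 1, b], vector [0, 0, 1]]"

definition heis_group :: "(real^3^3) monoid" where
  "heis_group = \<lparr>carrier = {heis_mat a b c | a b c. True}, mult = (**), one = mat 1\<rparr>"

definition heis_integer :: "(real^3^3) set" where
  "heis_integer = {heis_mat (of_int a) (of_int b) (of_int c) | a b c. True}"

lemma heis_mat_nth [simp]:
  "heis_mat a b c $ 1 $ 1 = 1" "heis_mat a b c $ 1 $ 2 = a" "heis_mat a b c $ 1 $ 3 = c"
  "heis_mat a b c $ 2 $ 1 = 0" "heis_mat a b c $ 2 $ 2 = 1" "heis_mat a b c $ 2 $ 3 = b"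
  "heis_mat a b c $ 3 $ 1 = 0" "heis_mat a b c $ 3 $ 2 = 0" "heis_mat a b c $ 3 $ 3 = 1"
  by (simp_all add: heis_mat_def)

lemma heis_mat_eq_iff [simp]:
  "heis_mat a b c = heis_mat a' b' c' \<longleftrightarrow> a = a' \<and> b = b' \<and> c = c'"
  by (metis heis_mat_nth(2,3,6))

lemma heis_mat_mult:
  "heis_mat a b c ** heis_mat a' b' c' = heis_mat (a + a') (b + b') (c + c' + a * b')"
  by (simp add: vec_eq_iff matrix_matrix_mult_def forall_3 sum_3)

lemma heis_mat_0: "heis_mat 0 0 0 = mat 1"
  by (simp add: vec_eq_iff mat_def forall_3)

lemma group_heis_group: "group heis_group"
proof (rule groupI)
  fix A assume "A \<in> carrier heis_group"
  then obtain a b c where A: "A = heis_mat a b c" by (auto simp: heis_group_def)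
  have "heis_mat (- a) (- b) (a * b - c) ** A = mat 1"
    by (simp add: A heis_mat_mult flip: heis_mat_0)
  then show "\<exists>B\<in>carrier heis_group. B \<otimes>\<^bsub>heis_group\<^esub> A = \<one>\<^bsub>heis_group\<^esub>"
    by (auto simp: heis_group_def)
qed (auto simp: heis_group_def heis_mat_mult matrix_mul_assoc simp flip: heis_mat_0)

lemma subgroup_heis_integer: "subgroup heis_integer heis_group"
proof (rule group.subgroupI[OF group_heis_group])
  show "heis_integer \<subseteq> carrier heis_group" "heis_integer \<noteq> {}"
    by (auto simp: heis_integer_def heis_group_def)
next
  fix A assume "A \<in> heis_integer"
  then obtain a b c where A: "A = heis_mat (of_int a) (of_int b) (of_int c)"
    by (auto simp: heis_integer_def)
  have "heis_mat (of_int (- a)) (of_int (- b)) (of_int (a * b - c)) ** A = mat 1"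
    by (simp add: A heis_mat_mult flip: heis_mat_0)
  then have "inv\<^bsub>heis_group\<^esub> A = heis_mat (of_int (- a)) (of_int (- b)) (of_int (a * b - c))"
    by (intro group.inv_equality[OF group_heis_group]) (auto simp: heis_group_def A)
  then show "inv\<^bsub>heis_group\<^esub> A \<in> heis_integer"
    unfolding heis_integer_def by blast
next
  fix A B assume "A \<in> heis_integer" "B \<in> heis_integer"
  then obtain a b c a' b' c' where "A = heis_mat (of_int a) (of_int b) (of_int c)"
    and "B = heis_mat (of_int a') (of_int b') (of_int c')"
    unfolding heis_integer_def by blast
  then have "A \<otimes>\<^bsub>heis_group\<^esub> B =
      heis_mat (of_int (a + a')) (of_int (b + b')) (of_int (c + c' + a * b'))"
    by (simp add: heis_group_def heis_mat_mult)
  then show "A \<otimes>\<^bsub>heis_group\<^esub> B \<in> heis_integer"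
    unfolding heis_integer_def by blast
qed


section \<open>The nil-manifold, the torus and the map between them\<close>

definition nil_proj :: "real^3^3 \<Rightarrow> (real^3^3) set" where
  "nil_proj g = heis_integer #>\<^bsub>heis_group\<^esub> g"

definition nil_manifold :: "(real^3^3) set topology" where
  "nil_manifold = quotient_topology (top_of_set (carrier heis_group)) nil_proj"

lemma topspace_nil_manifold:
  "topspace nil_manifold = rcosets\<^bsub>heis_group\<^esub> heis_integer"
  by (auto simp: nil_manifold_def nil_proj_def RCOSETS_def)

definition torus_proj :: "real \<times> real \<Rightarrow> (real \<times> real) set" where
  "torus_proj v = {(fst v + of_int m, snd v + of_int n) | m n. True}"

definition torus :: "(real \<times> real) set topology" where
  "torus = quotient_topology euclidean torus_proj"

text \<open>Points of both quotients are cosets, so the map induced by $(a,b,c) \mapsto (a,b)$ is the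
  image of a coset under it; see \<open>nil_to_torus_nil_proj\<close>.\<close>

definition nil_to_torus :: "(real^3^3) set \<Rightarrow> (real \<times> real) set" where
  "nil_to_torus C = (\<lambda>A. (A $ 1 $ 2, A $ 2 $ 3)) ` C"

lemma nil_proj_heis_mat:
  "nil_proj (heis_mat a b c) =
     {heis_mat (of_int k + a) (of_int l + b) (of_int m + c + of_int k * b) | k l m. True}"
proof -
  have "nil_proj (heis_mat a b c) = (\<lambda>A. A ** heis_mat a b c) ` heis_integer"
    by (auto simp: nil_proj_def r_coset_def heis_group_def)
  also have "heis_integer = (\<lambda>(k, l, m). heis_mat (of_int k) (of_int l) (of_int m)) ` UNIV"
    by (simp add: heis_integer_def set_eq_iff image_iff split_paired_Ex del: heis_mat_eq_iff)
  finally show ?thesis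
    by (simp add: set_eq_iff image_iff split_paired_Ex heis_mat_mult image_image case_prod_beta
        del: heis_mat_eq_iff)
qed

lemma nil_to_torus_nil_proj:
  "nil_to_torus (nil_proj (heis_mat a b c)) = torus_proj (a, b)"
proof -
  have "nil_proj (heis_mat a b c) =
      (\<lambda>(k, l, m). heis_mat (of_int k + a) (of_int l + b) (of_int m + c + of_int k * b)) ` UNIV"
    by (simp add: nil_proj_heis_mat set_eq_iff image_iff split_paired_Ex del: heis_mat_eq_iff)
  then have "nil_to_torus (nil_proj (heis_mat a b c)) =
      (\<lambda>(k, l, m :: int). (of_int k + a, of_int l + b)) ` UNIV"
    by (simp add: nil_to_torus_def image_image case_prod_beta)
  then show ?thesis
    by (simp add: torus_proj_def add.commute set_eq_iff image_iff split_paired_Ex)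
qed


section \<open>Curves\<close>

definition closed_curve :: "(real \<Rightarrow> 'a) \<Rightarrow> bool" where
  "closed_curve f \<longleftrightarrow> (\<exists>T>0. \<forall>t. f (t + T) = f t)"

text \<open>A curve of period \<open>T\<close> is a loop on the circle of length \<open>T\<close>; a homotopy of such loops is a
  homotopy through \<open>T\<close>-periodic curves. Contractibility is required for every period, hence in
  particular for the smallest one, and not only for some multiple of it.\<close>

definition contractible_closed_curve :: "'a topology \<Rightarrow> (real \<Rightarrow> 'a) \<Rightarrow> bool" where
  "contractible_closed_curve X f \<longleftrightarrow>
     continuous_map euclideanreal X f \<and> closed_curve f \<and>
     (\<forall>T>0. (\<forall>t. f (t + T) = f t) \<longrightarrow>
        (\<exists>c. homotopic_with (\<lambda>k. \<forall>t. k (t + T) = k t) euclideanreal X f (\<lambda>t. c)))"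

text \<open>The second conjunct rules out coincidences that come only from periodicity.\<close>

definition self_intersecting :: "(real \<Rightarrow> 'a) \<Rightarrow> bool" where
  "self_intersecting f \<longleftrightarrow> (\<exists>s t. f s = f t \<and> (\<exists>u. f (u + (t - s)) \<noteq> f u))"

definition dense_in :: "'a topology \<Rightarrow> 'a set \<Rightarrow> 'a set \<Rightarrow> bool" where
  "dense_in X S P \<longleftrightarrow> S \<subseteq> P \<and> P \<subseteq> topspace X \<and> (subtopology X P) closure_of S = P"


section \<open>Geodesic-spirals\<close>

text \<open>The coordinates $(x,y,z)$ satisfy $a = x$, $b = y$, $c = z + xy/2$.\<close>

definition heis_xyz :: "real \<Rightarrow> real \<Rightarrow> real \<Rightarrow> real^3^3" where
  "heis_xyz x y z = heis_mat x y (z + x * y / 2)"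

definition geodesic_spiral :: "real \<Rightarrow> real \<Rightarrow> real \<Rightarrow> real^3^3" where
  "geodesic_spiral \<theta> h t =
     heis_xyz ((sin (\<theta> + h * t) - sin \<theta>) / h)
              ((cos \<theta> - cos (\<theta> + h * t)) / h)
              ((h * t - sin (h * t)) / (2 * h\<^sup>2))"

definition nil_spiral :: "real \<Rightarrow> real \<Rightarrow> real \<Rightarrow> (real^3^3) set" where
  "nil_spiral \<theta> h t = nil_proj (geodesic_spiral \<theta> h t)"

definition torus_spiral :: "real \<Rightarrow> real \<Rightarrow> real \<Rightarrow> (real \<times> real) set" where
  "torus_spiral \<theta> h t = nil_to_torus (nil_spiral \<theta> h t)"

end

theory Submission
  imports Defs
begin

text \<open>
  In matrix coordinates a geodesic-spiral is a circle of radius \<open>1/\<bar>h\<bar>\<close> in the \<open>(a,b)\<close>-plane,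
  traversed with period \<open>2\<pi>/\<bar>h\<bar>\<close>, together with a height \<open>c\<close> that changes over each turn by
  the area \<open>\<pi>/h\<^sup>2\<close> of the disc that the turn encloses, with the sign of \<open>h\<close> (\<open>spiral_turns\<close>).

  The projection to the torus is therefore the image of a closed curve of the plane, and shrinking
  the circle linearly in the plane contracts it. Contractibility is asked for every period of the
  projected curve, so one must know that a period of the projection is a period of the circle: the
  displacement of a bounded continuous curve over such a period is a constant integer vector, and
  boundedness makes it zero (\<open>period_mod_integers\<close>).

  The same observation says that the projection to the nil-manifold can only close up after a whole
  number \<open>n\<close> of turns. Two points of the group over the same \<open>(a,b)\<close> have the same image exactly
  when their heights differ by an integer, so it does close up if and only if \<open>n\<pi>/h\<^sup>2\<close> is an
  integer for some \<open>n \<noteq> 0\<close>, that is, if \<open>\<pi>/h\<^sup>2\<close> is rational. Otherwise, over each point of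
  \<open>\<gamma>\<close> successive turns move along the circle fibre by an irrational rotation, whose orbits are
  dense by Kronecker's theorem (\<open>fibre_rotation_dense\<close>).
\<close>


section \<open>Periods modulo the integers\<close>

text \<open>The displacement \<open>f (t + T) - f t\<close> is continuous and integral, hence constant; a non-zero
  constant would make \<open>f\<close> unbounded along \<open>t + nT\<close>.\<close>

lemma period_mod_integers:
  fixes f :: "real \<Rightarrow> real"
  assumes cont: "continuous_on UNIV f" and bdd: "\<And>t. \<bar>f t\<bar> \<le> B"
    and int: "\<And>t. f (t + T) - f t \<in> \<int>"
  shows "f (t + T) = f t"
proof -
  have "continuous_on UNIV (\<lambda>t. f (t + T) - f t)"
    by (intro continuous_intros continuous_on_compose2[OF cont]) auto
  then have "(\<lambda>t. f (t + T) - f t) constant_on UNIV"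
  proof (rule continuous_discrete_range_constant[OF connected_UNIV])
    fix x
    have "1 \<le> norm (f (y + T) - f y - (f (x + T) - f x))"
      if "f (y + T) - f y \<noteq> f (x + T) - f x" for y
      using that int[of x] int[of y] by (metis Ints_diff Ints_nonzero_abs_ge1 eq_iff_diff_eq_0 real_norm_def)
    then show "\<exists>e>0. \<forall>y. y \<in> UNIV \<and> f (y + T) - f y \<noteq> f (x + T) - f x \<longrightarrow>
        e \<le> norm (f (y + T) - f y - (f (x + T) - f x))"
      by (intro exI[of _ 1]) auto
  qed
  then obtain d where "\<And>t. f (t + T) - f t = d"
    unfolding constant_on_def by auto
  then have d: "f (t + T) = f t + d" for t
    by (metis add_diff_cancel_left' add.commute diff_add_cancel)
  have iter: "f (real n * T) = f 0 + real n * d" for n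
  proof (induction n)
    case (Suc n)
    have "f (real (Suc n) * T) = f (real n * T + T)" by (simp add: algebra_simps)
    then show ?case using Suc d[of "real n * T"] by (simp add: algebra_simps)
  qed simp
  have "d = 0"
  proof (rule ccontr)
    assume "d \<noteq> 0"
    then obtain n where "real n * \<bar>d\<bar> > 2 * B"
      using reals_Archimedean3[of "\<bar>d\<bar>"] by auto
    moreover have "real n * \<bar>d\<bar> = \<bar>f (real n * T) - f 0\<bar>"
      by (simp add: iter abs_mult)
    ultimately show False
      using bdd[of "real n * T"] bdd[of 0] by linarith
  qed
  then show ?thesis using d by simp
qed


section \<open>The quotient projections\<close>

lemma torus_proj_eq_iff:
  "torus_proj (a, b) = torus_proj (a', b') \<longleftrightarrow> a' - a \<in> \<int> \<and> b' - b \<in> \<int>"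
proof
  assume "torus_proj (a, b) = torus_proj (a', b')"
  moreover have "(a', b') \<in> torus_proj (a', b')"
    by (auto simp: torus_proj_def intro: exI[of _ 0])
  ultimately have "(a', b') \<in> torus_proj (a, b)" by simp
  then show "a' - a \<in> \<int> \<and> b' - b \<in> \<int>"
    by (auto simp: torus_proj_def)
next
  assume "a' - a \<in> \<int> \<and> b' - b \<in> \<int>"
  then obtain k l where "a' - a = of_int k" "b' - b = of_int l"
    by (auto elim!: Ints_cases)
  then have k: "a' = a + of_int k" "b' = b + of_int l" by auto
  have "p \<in> torus_proj (a, b) \<longleftrightarrow> p \<in> torus_proj (a', b')" for p
    unfolding torus_proj_def mem_Collect_eq fst_conv snd_conv simp_thms
  proof (intro iffI; elim exE)
    fix m n assume "p = (a + of_int m, b + of_int n)"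
    then show "\<exists>m n. p = (a' + of_int m, b' + of_int n)"
      by (intro exI[of _ "m - k"] exI[of _ "n - l"]) (simp add: k)
  next
    fix m n assume "p = (a' + of_int m, b' + of_int n)"
    then show "\<exists>m n. p = (a + of_int m, b + of_int n)"
      by (intro exI[of _ "k + m"] exI[of _ "l + n"]) (simp add: k)
  qed
  then show "torus_proj (a, b) = torus_proj (a', b')"
    by blast
qed

lemma mem_nil_proj_iff:
  "heis_mat a' b' c' \<in> nil_proj (heis_mat a b c) \<longleftrightarrow>
     (\<exists>k l m. a' = of_int k + a \<and> b' = of_int l + b \<and> c' = of_int m + c + of_int k * b)"
  by (auto simp: nil_proj_heis_mat)

lemma nil_proj_eq_iff:
  "nil_proj (heis_mat a' b' c') = nil_proj (heis_mat a b c) \<longleftrightarrow>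
     heis_mat a' b' c' \<in> nil_proj (heis_mat a b c)"
proof -
  interpret group heis_group by (rule group_heis_group)
  have carrier: "heis_mat a b c \<in> carrier heis_group" for a b c
    by (auto simp: heis_group_def)
  show ?thesis
    unfolding nil_proj_def
    by (metis carrier rcos_self repr_independence subgroup_heis_integer)
qed

lemma nil_proj_eq_same_base_iff:
  "nil_proj (heis_mat a b c') = nil_proj (heis_mat a b c) \<longleftrightarrow> c' - c \<in> \<int>"
  by (auto simp: nil_proj_eq_iff mem_nil_proj_iff elim!: Ints_cases)
    (metis add.commute diff_add_cancel)

text \<open>Left multiplication by an integer matrix shifts \<open>(a,b)\<close> by any integer vector, at the cost of
  a change of height; so a point of the nil-manifold over \<open>torus_proj (a, b)\<close> has a representative
  with these very \<open>a\<close> and \<open>b\<close>.\<close>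

lemma nil_manifold_representative_over:
  assumes "m \<in> topspace nil_manifold" "nil_to_torus m = torus_proj (a, b)"
  obtains c where "m = nil_proj (heis_mat a b c)"
proof -
  from assms(1) obtain a' b' c' where m: "m = nil_proj (heis_mat a' b' c')"
    by (auto simp: nil_manifold_def heis_group_def)
  then have "torus_proj (a', b') = torus_proj (a, b)"
    using assms(2) by (simp add: nil_to_torus_nil_proj)
  then obtain k l where "a - a' = of_int k" "b - b' = of_int l"
    by (auto simp: torus_proj_eq_iff elim!: Ints_cases)
  then have "heis_mat a b (c' + of_int k * b') \<in> nil_proj (heis_mat a' b' c')"
    unfolding mem_nil_proj_iff
    by (intro exI[of _ k] exI[of _ l] exI[of _ 0]) auto
  then have "m = nil_proj (heis_mat a b (c' + of_int k * b'))"
    unfolding m by (simp only: nil_proj_eq_iff[symmetric])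
  then show thesis by (rule that)
qed

lemma continuous_map_torus_proj: "continuous_map euclidean torus torus_proj"
  unfolding torus_def
  by (rule quotient_imp_continuous_map[OF quotient_map_quotient_topology])

lemma continuous_map_nil_proj_fibre:
  "continuous_map euclideanreal nil_manifold (\<lambda>c. nil_proj (heis_mat a b c))"
proof -
  have eq: "heis_mat a b c = heis_mat a b 0 + c *\<^sub>R (heis_mat 0 0 1 - heis_mat 0 0 0)" for c
    by (simp add: vec_eq_iff forall_3)
  have "continuous_on UNIV (\<lambda>c. heis_mat a b c)"
    by (subst eq) (intro continuous_intros)
  then have "continuous_map euclideanreal (top_of_set (carrier heis_group)) (\<lambda>c. heis_mat a b c)"
    by (auto simp: continuous_map_in_subtopology heis_group_def)
  moreover have "continuous_map (top_of_set (carrier heis_group)) nil_manifold nil_proj"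
    unfolding nil_manifold_def
    by (rule quotient_imp_continuous_map[OF quotient_map_quotient_topology])
  ultimately show ?thesis
    using continuous_map_compose[of _ _ "\<lambda>c. heis_mat a b c" _ nil_proj] by (simp add: o_def)
qed

text \<open>On the circle fibre over a point, adding \<open>\<alpha>\<close> to the height is a rotation, and for irrational
  \<open>\<alpha>\<close> every orbit accumulates at every point of the fibre: by Kronecker's theorem the heights
  \<open>c + n\<alpha>\<close> come arbitrarily close to any given one modulo the integers.\<close>

lemma fibre_rotation_dense:
  assumes irr: "\<alpha> \<notin> \<rat>"
    and U: "openin nil_manifold U" "nil_proj (heis_mat a b c') \<in> U"
  obtains n :: int where "nil_proj (heis_mat a b (c + of_int n * \<alpha>)) \<in> U"
proof -
  have "open {d. nil_proj (heis_mat a b d) \<in> U}"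
    using openin_continuous_map_preimage[OF continuous_map_nil_proj_fibre U(1)] by simp
  then obtain e where e: "e > 0" "\<And>d. \<bar>d - c'\<bar> < e \<Longrightarrow> nil_proj (heis_mat a b d) \<in> U"
    using U(2) unfolding open_dist by (force simp: dist_real_def)
  obtain k n where "\<bar>of_int n * \<alpha> - of_int k - (c' - c)\<bar> < e"
    using sequence_of_fractional_parts_is_dense[OF irr e(1)] by metis
  then have "nil_proj (heis_mat a b (c + of_int n * \<alpha> - of_int k)) \<in> U"
    by (intro e(2)) (simp add: algebra_simps)
  moreover have "nil_proj (heis_mat a b (c + of_int n * \<alpha> - of_int k)) =
      nil_proj (heis_mat a b (c + of_int n * \<alpha>))"
    by (simp add: nil_proj_eq_same_base_iff)
  ultimately show thesis using that by simp
qed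


section \<open>The spiral in matrix coordinates\<close>

definition spiral_a :: "real \<Rightarrow> real \<Rightarrow> real \<Rightarrow> real" where
  "spiral_a \<theta> h t = (sin (\<theta> + h * t) - sin \<theta>) / h"

definition spiral_b :: "real \<Rightarrow> real \<Rightarrow> real \<Rightarrow> real" where
  "spiral_b \<theta> h t = (cos \<theta> - cos (\<theta> + h * t)) / h"

definition spiral_c :: "real \<Rightarrow> real \<Rightarrow> real \<Rightarrow> real" where
  "spiral_c \<theta> h t =
     (h * t - sin (h * t)) / (2 * h\<^sup>2) + spiral_a \<theta> h t * spiral_b \<theta> h t / 2"

lemma nil_spiral_eq:
  "nil_spiral \<theta> h t = nil_proj (heis_mat (spiral_a \<theta> h t) (spiral_b \<theta> h t) (spiral_c \<theta> h t))"
  by (simp add: nil_spiral_def geodesic_spiral_def heis_xyz_def spiral_a_def spiral_b_def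
      spiral_c_def)

lemma torus_spiral_eq: "torus_spiral \<theta> h t = torus_proj (spiral_a \<theta> h t, spiral_b \<theta> h t)"
  by (simp add: torus_spiral_def nil_spiral_eq nil_to_torus_nil_proj)

lemma continuous_on_spiral:
  assumes "h \<noteq> 0"
  shows "continuous_on S (spiral_a \<theta> h)" "continuous_on S (spiral_b \<theta> h)"
  unfolding spiral_a_def spiral_b_def using assms by (auto intro!: continuous_intros)

lemma spiral_bounded:
  shows "\<bar>spiral_a \<theta> h t\<bar> \<le> 2 / \<bar>h\<bar>" "\<bar>spiral_b \<theta> h t\<bar> \<le> 2 / \<bar>h\<bar>"
proof -
  have "\<bar>sin (\<theta> + h * t) - sin \<theta>\<bar> \<le> 2"
    using abs_sin_le_one[of "\<theta> + h * t"] abs_sin_le_one[of \<theta>] by linarith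
  then show "\<bar>spiral_a \<theta> h t\<bar> \<le> 2 / \<bar>h\<bar>"
    by (simp add: spiral_a_def abs_divide divide_right_mono)
  have "\<bar>cos \<theta> - cos (\<theta> + h * t)\<bar> \<le> 2"
    using abs_cos_le_one[of "\<theta> + h * t"] abs_cos_le_one[of \<theta>] by linarith
  then show "\<bar>spiral_b \<theta> h t\<bar> \<le> 2 / \<bar>h\<bar>"
    by (simp add: spiral_b_def abs_divide divide_right_mono)
qed

text \<open>Over \<open>n\<close> turns only the linear term \<open>ht / 2h\<^sup>2\<close> of the height changes.\<close>

lemma spiral_turns:
  assumes "h \<noteq> 0" "h * T = 2 * pi * of_int n"
  shows "spiral_a \<theta> h (t + T) = spiral_a \<theta> h t"
    and "spiral_b \<theta> h (t + T) = spiral_b \<theta> h t"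
    and "spiral_c \<theta> h (t + T) = spiral_c \<theta> h t + of_int n * (pi / h\<^sup>2)"
proof -
  have shift: "h * (t + T) = h * t + 2 * pi * of_int n" "\<theta> + h * (t + T) = (\<theta> + h * t) + 2 * pi * of_int n"
    using assms(2) by (simp_all add: algebra_simps)
  have per: "sin (x + 2 * pi * of_int n) = sin x" "cos (x + 2 * pi * of_int n) = cos x" for x
    by (simp_all add: sin_add cos_add)
  show ab: "spiral_a \<theta> h (t + T) = spiral_a \<theta> h t" "spiral_b \<theta> h (t + T) = spiral_b \<theta> h t"
    by (simp_all only: spiral_a_def spiral_b_def shift(2) per)
  have "(h * t + 2 * pi * of_int n - sin (h * t)) / (2 * h\<^sup>2) =
      (h * t - sin (h * t)) / (2 * h\<^sup>2) + of_int n * (pi / h\<^sup>2)"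
    using assms(1) by (simp add: field_simps)
  then show "spiral_c \<theta> h (t + T) = spiral_c \<theta> h t + of_int n * (pi / h\<^sup>2)"
    by (simp only: spiral_c_def ab shift(1) per)
qed


section \<open>Periods of the projected spirals\<close>

text \<open>Wrapping around the torus creates no new periods: one of the projected curve is already one
  of the circle, by boundedness of the circle.\<close>

lemma torus_spiral_period_imp:
  assumes h: "h \<noteq> 0" and per: "\<And>t. torus_spiral \<theta> h (t + T) = torus_spiral \<theta> h t"
  obtains n :: int where "h * T = 2 * pi * of_int n"
proof -
  have "spiral_a \<theta> h t - spiral_a \<theta> h (t + T) \<in> \<int>" for t
    using per[of t] by (simp add: torus_spiral_eq torus_proj_eq_iff)
  then have "spiral_a \<theta> h (t + T) - spiral_a \<theta> h t \<in> \<int>" for t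
    by (metis Ints_minus minus_diff_eq)
  then have a: "spiral_a \<theta> h (t + T) = spiral_a \<theta> h t" for t
    by (rule period_mod_integers[OF continuous_on_spiral(1)[OF h] spiral_bounded(1)])
  \<comment> \<open>At this parameter the sine attains its maximum, and a shift that fixes the maximum is a
    multiple of \<open>2\<pi>\<close>.\<close>
  define s where "s = (pi / 2 - \<theta>) / h"
  have s: "\<theta> + h * s = pi / 2" "\<theta> + h * (s + T) = pi / 2 + h * T"
    using h by (simp_all add: s_def field_simps)
  have "sin (pi / 2 + h * T) = sin (pi / 2)"
    using a[of s] h unfolding spiral_a_def s by simp
  then have "cos (h * T) = 1"
    by (simp only: sin_add) simp
  then show thesis
    using that by (auto simp: cos_one_2pi_int mult_ac)
qed

lemma nil_spiral_turns:
  assumes "h \<noteq> 0" "h * T = 2 * pi * of_int n"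
  shows "nil_spiral \<theta> h (t + T) = nil_spiral \<theta> h t \<longleftrightarrow> of_int n * (pi / h\<^sup>2) \<in> \<int>"
  by (simp only: nil_spiral_eq spiral_turns[OF assms] nil_proj_eq_same_base_iff add_diff_cancel_left')

lemma mem_pi_rationals_iff:
  assumes "h \<noteq> 0"
  shows "h\<^sup>2 \<in> (*) pi ` \<rat> \<longleftrightarrow> pi / h\<^sup>2 \<in> \<rat>"
proof
  assume "h\<^sup>2 \<in> (*) pi ` \<rat>"
  then obtain q where q: "q \<in> \<rat>" "h\<^sup>2 = pi * q" by auto
  then have "pi / h\<^sup>2 = inverse q" by (simp add: field_simps)
  then show "pi / h\<^sup>2 \<in> \<rat>" using q by simp
next
  assume "pi / h\<^sup>2 \<in> \<rat>"
  then have "inverse (pi / h\<^sup>2) \<in> \<rat>" by (rule Rats_inverse)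
  moreover have "h\<^sup>2 = pi * inverse (pi / h\<^sup>2)" using assms by (simp add: field_simps)
  ultimately show "h\<^sup>2 \<in> (*) pi ` \<rat>" by blast
qed

lemma closed_curve_nil_spiral_iff:
  assumes h: "h \<noteq> 0"
  shows "closed_curve (nil_spiral \<theta> h) \<longleftrightarrow> pi / h\<^sup>2 \<in> \<rat>"
proof
  assume "closed_curve (nil_spiral \<theta> h)"
  then obtain T where T: "T > 0" and per: "\<And>t. nil_spiral \<theta> h (t + T) = nil_spiral \<theta> h t"
    by (auto simp: closed_curve_def)
  have "torus_spiral \<theta> h (t + T) = torus_spiral \<theta> h t" for t
    by (simp add: torus_spiral_def per)
  then obtain n where n: "h * T = 2 * pi * of_int n"
    by (rule torus_spiral_period_imp[OF h])
  then have "n \<noteq> 0" using T h by auto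
  moreover have "of_int n * (pi / h\<^sup>2) \<in> \<rat>"
    using nil_spiral_turns[OF h n] per Ints_subset_Rats by blast
  then have "of_int n * (pi / h\<^sup>2) / of_int n \<in> \<rat>"
    by (rule Rats_divide) simp
  ultimately show "pi / h\<^sup>2 \<in> \<rat>" by simp
next
  assume "pi / h\<^sup>2 \<in> \<rat>"
  then obtain p q where q: "q > 0" and pq: "pi / h\<^sup>2 = of_int p / of_int q"
    by (metis Rats_cases')
  \<comment> \<open>A period has to be positive, so the direction of the turns follows the sign of \<open>h\<close>.\<close>
  define n where "n = (if h > 0 then q else - q)"
  define T where "T = 2 * pi * of_int n / h"
  have T: "T > 0" "h * T = 2 * pi * of_int n"
    using q h by (auto simp: T_def n_def zero_less_divide_iff mult_pos_neg field_simps)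
  have "of_int n * (pi / h\<^sup>2) \<in> \<int>"
    using q by (simp add: pq n_def)
  then have "nil_spiral \<theta> h (t + T) = nil_spiral \<theta> h t" for t
    by (simp add: nil_spiral_turns[OF h T(2)])
  then show "closed_curve (nil_spiral \<theta> h)"
    unfolding closed_curve_def using T(1) by blast
qed


section \<open>The curve on the torus\<close>

text \<open>The circle is shrunk linearly in the plane to its base point \<open>(0, 0)\<close> and the result is
  projected. All stages keep the given period of the torus curve, because such a period is a whole
  number of turns of the circle itself.\<close>

lemma contractible_torus_spiral:
  assumes h: "h \<noteq> 0"
  shows "contractible_closed_curve torus (torus_spiral \<theta> h)"
proof -
  define H where "H = (\<lambda>x :: real \<times> real.
      torus_proj ((1 - fst x) * spiral_a \<theta> h (snd x), (1 - fst x) * spiral_b \<theta> h (snd x)))"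
  have "continuous_on ({0..1} \<times> UNIV)
      (\<lambda>x. ((1 - fst x) * spiral_a \<theta> h (snd x), (1 - fst x) * spiral_b \<theta> h (snd x)))"
    by (intro continuous_intros continuous_on_compose2[OF continuous_on_spiral(1)[OF h]]
        continuous_on_compose2[OF continuous_on_spiral(2)[OF h]]) (auto intro: h)
  then have "continuous_map (top_of_set ({0..1} \<times> UNIV)) euclidean
      (\<lambda>x. ((1 - fst x) * spiral_a \<theta> h (snd x), (1 - fst x) * spiral_b \<theta> h (snd x)))"
    by simp
  from continuous_map_compose[OF this continuous_map_torus_proj]
  have "continuous_map (top_of_set ({0..1} \<times> UNIV)) torus H"
    by (simp add: H_def o_def)
  moreover have "prod_topology (top_of_set {0..1}) euclideanreal =
      top_of_set ({0..1 :: real} \<times> UNIV)"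
    using prod_topology_subtopology_eu[of "{0..1 :: real}" "UNIV :: real set"] by simp
  ultimately have H: "continuous_map (prod_topology (top_of_set {0..1}) euclideanreal) torus H"
    by simp
  have "homotopic_with (\<lambda>k. \<forall>t. k (t + T) = k t) euclideanreal torus
      (torus_spiral \<theta> h) (\<lambda>t. torus_proj (0, 0))"
    if per: "\<And>t. torus_spiral \<theta> h (t + T) = torus_spiral \<theta> h t" for T
  proof -
    obtain n where n: "h * T = 2 * pi * of_int n"
      by (rule torus_spiral_period_imp[OF h per])
    show ?thesis
      unfolding homotopic_with_def
      by (intro exI[of _ H] conjI H) (auto simp: H_def torus_spiral_eq spiral_turns[OF h n])
  qed
  then have hom: "\<exists>c. homotopic_with (\<lambda>k. \<forall>t. k (t + T) = k t) euclideanreal torus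
      (torus_spiral \<theta> h) (\<lambda>t. c)"
    if "\<forall>t. torus_spiral \<theta> h (t + T) = torus_spiral \<theta> h t" for T
    using that by blast
  have "continuous_map euclideanreal euclidean (\<lambda>t. (spiral_a \<theta> h t, spiral_b \<theta> h t))"
    by (simp add: continuous_on_Pair continuous_on_spiral[OF h])
  from continuous_map_compose[OF this continuous_map_torus_proj]
  have cont: "continuous_map euclideanreal torus (torus_spiral \<theta> h)"
    by (simp add: o_def torus_spiral_eq[abs_def])
  define T where "T = 2 * pi / \<bar>h\<bar>"
  have T: "T > 0" "h * T = 2 * pi * of_int (if h > 0 then 1 else - 1)"
    using h by (auto simp: T_def)
  have "closed_curve (torus_spiral \<theta> h)"
    unfolding closed_curve_def using T(1)
    by (intro exI[of _ T]) (simp add: torus_spiral_eq spiral_turns[OF h T(2)])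
  with cont hom show ?thesis
    unfolding contractible_closed_curve_def by blast
qed

text \<open>The unit circle is wide enough to meet its translate by \<open>(1, 0)\<close>: the two points at angles
  \<open>\<plusminus>\<pi>/6\<close> differ by exactly that vector.\<close>

lemma self_intersecting_unit_torus_spiral: "self_intersecting (torus_spiral 0 1)"
  unfolding self_intersecting_def
proof (intro exI conjI)
  show "torus_spiral 0 1 (- (pi / 6)) = torus_spiral 0 1 (pi / 6)"
    by (simp add: torus_spiral_eq torus_proj_eq_iff spiral_a_def spiral_b_def sin_30)
  have "(1 / 2 :: real) \<notin> \<int>"
    using Ints_nonzero_abs_less1[of "1 / 2 :: real"] by auto
  moreover have "spiral_b 0 1 (pi / 3) = 1 / 2" "spiral_b 0 1 0 = 0"
    by (simp_all add: spiral_b_def cos_60)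
  moreover have "0 + (pi / 6 - - (pi / 6)) = pi / 3" by simp
  ultimately show "torus_spiral 0 1 (0 + (pi / 6 - - (pi / 6))) \<noteq> torus_spiral 0 1 0"
    by (metis diff_0 minus_in_Ints_iff torus_proj_eq_iff torus_spiral_eq)
qed


section \<open>Density over the curve on the torus\<close>

lemma dense_nil_spiral:
  assumes h: "h \<noteq> 0" and irr: "pi / h\<^sup>2 \<notin> \<rat>"
  shows "dense_in nil_manifold (range (nil_spiral \<theta> h))
           {m \<in> topspace nil_manifold. nil_to_torus m \<in> range (torus_spiral \<theta> h)}"
    (is "dense_in _ ?S ?P")
proof -
  have sub: "?S \<subseteq> ?P"
    by (auto simp: torus_spiral_def nil_spiral_eq nil_manifold_def heis_group_def)
  have "m \<in> subtopology nil_manifold ?P closure_of ?S" if m: "m \<in> ?P" for m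
  proof -
    from m obtain t where t: "nil_to_torus m = torus_proj (spiral_a \<theta> h t, spiral_b \<theta> h t)"
      by (auto simp: torus_spiral_eq)
    then obtain c' where c': "m = nil_proj (heis_mat (spiral_a \<theta> h t) (spiral_b \<theta> h t) c')"
      using nil_manifold_representative_over m by blast
    have "\<exists>y. y \<in> ?S \<and> y \<in> U" if U: "openin nil_manifold U" "m \<in> U" for U
    proof -
      obtain n where n: "nil_proj (heis_mat (spiral_a \<theta> h t) (spiral_b \<theta> h t)
          (spiral_c \<theta> h t + of_int n * (pi / h\<^sup>2))) \<in> U"
        using fibre_rotation_dense[OF irr U(1)] U(2) c' by metis
      have turns: "h * (2 * pi * of_int n / h) = 2 * pi * of_int n" using h by simp
      from n have "nil_spiral \<theta> h (t + 2 * pi * of_int n / h) \<in> U"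
        by (simp only: nil_spiral_eq spiral_turns[OF h turns])
      then show ?thesis by blast
    qed
    then have "m \<in> nil_manifold closure_of ?S"
      using m by (auto simp: in_closure_of)
    then show ?thesis
      using m sub by (auto simp: closure_of_subtopology Int_absorb1)
  qed
  then have "subtopology nil_manifold ?P closure_of ?S = ?P"
    using closure_of_subset_topspace[of "subtopology nil_manifold ?P" ?S] by auto
  with sub show ?thesis
    unfolding dense_in_def by auto
qed

theorem theorem6p1:
  fixes \<theta> h :: real
  assumes "h \<noteq> 0"
  shows "(contractible_closed_curve torus (torus_spiral \<theta> h) \<and>
          (\<exists>\<theta>' h'. h' \<noteq> 0 \<and> self_intersecting (torus_spiral \<theta>' h'))) \<and>
         (closed_curve (nil_spiral \<theta> h) \<longleftrightarrow> h\<^sup>2 \<in> (*) pi ` \<rat> - {0}) \<and>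
         (h\<^sup>2 \<notin> (*) pi ` \<rat> \<longrightarrow>
            dense_in nil_manifold (range (nil_spiral \<theta> h))
              {m \<in> topspace nil_manifold. nil_to_torus m \<in> range (torus_spiral \<theta> h)})"
proof (intro conjI impI)
  show "contractible_closed_curve torus (torus_spiral \<theta> h)"
    by (rule contractible_torus_spiral[OF assms])
  show "\<exists>\<theta>' h'. h' \<noteq> 0 \<and> self_intersecting (torus_spiral \<theta>' h')"
    using self_intersecting_unit_torus_spiral zero_neq_one by metis
  show "closed_curve (nil_spiral \<theta> h) \<longleftrightarrow> h\<^sup>2 \<in> (*) pi ` \<rat> - {0}"
    using closed_curve_nil_spiral_iff[OF assms] mem_pi_rationals_iff[OF assms] assms by simp
  show "dense_in nil_manifold (range (nil_spiral \<theta> h))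
      {m \<in> topspace nil_manifold. nil_to_torus m \<in> range (torus_spiral \<theta> h)}"
    if "h\<^sup>2 \<notin> (*) pi ` \<rat>"
    using that dense_nil_spiral[OF assms] mem_pi_rationals_iff[OF assms] by simp
qed

end
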